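(* The lattice of subTuring degrees is not modular; that is, there exist subTuring degrees $\mathbf{a},\mathbf{b},\mathbf{c}$ with $\mathbf{a}\leq\mathbf{b}$ and $\mathbf{a}\vee(\mathbf{b}\wedge\mathbf{c})\neq\mathbf{b}\wedge(\mathbf{a}\vee\mathbf{c})$.
   Context: For a partial computable function $\Phi$ from finite sequences of natural numbers to $\{0,1\}\times\omega$ and a partial function $g\colon\subseteq\omega\to\omega$, the $g$-relative sequential computation $\Phi[g]$ is defined as follows. On input $n$, with oracle answers $a_0,\dots,a_{s-1}$ obtained so far: if $\Phi(n,a_0,\dots,a_{s-1})$ is undefined, $\Phi[g](n)$ is undefined; if it equals $\langle 1,q\rangle$ the computation halts with output $q$; if it equals $\langle 0,q\rangle$, $q$ is a query, and if $q\in{\rm dom}(g)$ the computation continues with $a_s=g(q)$, while if $q\notin{\rm dom}(g)$ the computation never halts. $\Phi_e$ is the $e$-th such partial computable function. $f\leq_{\rm subT} g$ means $f\subseteq\Phi_e[g]$ for some $e$; subTuring degrees are $\equiv_{\rm subT}$-classes ordered by $\leq_{\rm subT}$. The join $\vee$ is induced by $(f\oplus g)(2n)=f(n)$, $(f\oplus g)(2n+1)=g(n)$, and the meet $\wedge$ by $(f\cap g)(\langle d,e,n\rangle)=\Phi_d[f](n)$ if $\Phi_d[f](n)$ and $\Phi_e[g](n)$ are both defined and equal, undefined otherwise. *)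

theory Defs
  imports Complex_Main "HOL-Library.Nat_Bijection"
begin

text \<open>
  Partial recursive functions in unary form: tuples of arguments are coded by the Cantor pairing
  \<^const>\<open>prod_encode\<close>. \<open>Prec f g\<close> is primitive recursion with parameter \<open>a\<close> on coded
  arguments \<open>(a, n)\<close>; \<open>Mn f\<close> maps \<open>a\<close> to the least \<open>n\<close> with \<open>f (a, n) = 0\<close>, provided that
  \<open>f (a, m)\<close> is defined for all \<open>m < n\<close>.
\<close>

datatype recf =
    Zero
  | Succ
  | Fst
  | Snd
  | Pairing recf recf
  | Comp recf recf
  | Prec recf recf
  | Mn recf

primrec eval :: "recf \<Rightarrow> nat \<rightharpoonup> nat" where
  "eval Zero = (\<lambda>x. Some 0)"
| "eval Succ = (\<lambda>x. Some (Suc x))"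
| "eval Fst = (\<lambda>x. Some (fst (prod_decode x)))"
| "eval Snd = (\<lambda>x. Some (snd (prod_decode x)))"
| "eval (Pairing f g) =
     (\<lambda>x. Option.bind (eval f x) (\<lambda>y. Option.bind (eval g x) (\<lambda>z. Some (prod_encode (y, z)))))"
| "eval (Comp f g) = eval f \<circ>\<^sub>m eval g"
| "eval (Prec f g) =
     (\<lambda>x. case prod_decode x of (a, n) \<Rightarrow>
        rec_nat (eval f a)
          (\<lambda>m r. Option.bind r (\<lambda>y. eval g (prod_encode (a, prod_encode (m, y))))) n)"
| "eval (Mn f) =
     (\<lambda>a. let P = (\<lambda>n. eval f (prod_encode (a, n)) = Some 0 \<and>
                       (\<forall>m<n. eval f (prod_encode (a, m)) \<noteq> None))
          in if \<exists>n. P n then Some (LEAST n. P n) else None)"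

text \<open>
  The numbering has to be effective, and not merely surjective, since indices occur as arguments
  in the definition of the meet below.
\<close>

fun recf_index :: "recf \<Rightarrow> nat" where
  "recf_index Zero = 0"
| "recf_index Succ = 1"
| "recf_index Fst = 2"
| "recf_index Snd = 3"
| "recf_index (Pairing f g) = 4 + 4 * prod_encode (recf_index f, recf_index g)"
| "recf_index (Comp f g) = 5 + 4 * prod_encode (recf_index f, recf_index g)"
| "recf_index (Prec f g) = 6 + 4 * prod_encode (recf_index f, recf_index g)"
| "recf_index (Mn f) = 7 + 4 * recf_index f"

lemma prod_decode_le:
  "fst (prod_decode k) \<le> k" "snd (prod_decode k) \<le> k"
  by (metis le_prod_encode_1 prod.collapse prod_decode_inverse)
     (metis le_prod_encode_2 prod.collapse prod_decode_inverse)

function recf_of :: "nat \<Rightarrow> recf" where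
  "recf_of e =
     (if e = 0 then Zero
      else if e = 1 then Succ
      else if e = 2 then Fst
      else if e = 3 then Snd
      else
        let k = (e - 4) div 4;
            i = fst (prod_decode k);
            j = snd (prod_decode k)
        in if e mod 4 = 0 then Pairing (recf_of i) (recf_of j)
           else if e mod 4 = 1 then Comp (recf_of i) (recf_of j)
           else if e mod 4 = 2 then Prec (recf_of i) (recf_of j)
           else Mn (recf_of k))"
  by pat_completeness auto
termination
proof (relation "measure (\<lambda>e. e)", goal_cases)
qed (auto intro: le_less_trans[OF prod_decode_le(1)] le_less_trans[OF prod_decode_le(2)])

declare recf_of.simps [simp del]

lemma recf_of_index: "recf_of (recf_index c) = c"
proof (induction c)
  case (Pairing f g)
  then show ?case by (subst recf_of.simps) (simp add: Let_def mod_simps)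
next
  case (Comp f g)
  have "(5 + 4 * k) mod 4 = (1::nat)" "(1 + 4 * k) div 4 = k" for k :: nat by presburger+
  with Comp show ?case by (subst recf_of.simps) (simp add: Let_def)
next
  case (Prec f g)
  have "(6 + 4 * k) mod 4 = (2::nat)" "(2 + 4 * k) div 4 = k" for k :: nat by presburger+
  with Prec show ?case by (subst recf_of.simps) (simp add: Let_def)
next
  case (Mn f)
  have "(7 + 4 * k) mod 4 = (3::nat)" "(3 + 4 * k) div 4 = k" for k :: nat by presburger+
  with Mn show ?case by (subst recf_of.simps) (simp add: Let_def)
qed (simp_all add: recf_of.simps)

text \<open>
  \<open>\<Phi>\<^sub>e\<close>, as a partial function from finite sequences to \<open>{0,1} \<times> \<omega>\<close>. Values are coded by
  the bijection \<open>(i, q) \<mapsto> 2 * q + i\<close>, so that every index yields a function of this kind.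
\<close>

definition Phi :: "nat \<Rightarrow> nat list \<rightharpoonup> nat \<times> nat" where
  "Phi e \<sigma> = map_option (\<lambda>y. (y mod 2, y div 2)) (eval (recf_of e) (list_encode \<sigma>))"

text \<open>\<^const>\<open>None\<close> results also from an infinite sequence of queries (least fixed point).\<close>

partial_function (option) run ::
    "(nat list \<rightharpoonup> nat \<times> nat) \<Rightarrow> (nat \<rightharpoonup> nat) \<Rightarrow> nat list \<Rightarrow> nat option" where
  "run F g \<sigma> =
     Option.bind (F \<sigma>) (\<lambda>(i, q).
       if i = 1 then Some q
       else Option.bind (g q) (\<lambda>a. run F g (\<sigma> @ [a])))"

definition seq_comp :: "(nat list \<rightharpoonup> nat \<times> nat) \<Rightarrow> (nat \<rightharpoonup> nat) \<Rightarrow> nat \<rightharpoonup> nat" where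
  "seq_comp F g n = run F g [n]"

definition subT_le :: "(nat \<rightharpoonup> nat) \<Rightarrow> (nat \<rightharpoonup> nat) \<Rightarrow> bool" (infix "\<le>\<^sub>s\<^sub>u\<^sub>b\<^sub>T" 50) where
  "f \<le>\<^sub>s\<^sub>u\<^sub>b\<^sub>T g \<longleftrightarrow> (\<exists>e. f \<subseteq>\<^sub>m seq_comp (Phi e) g)"

definition subT_join :: "(nat \<rightharpoonup> nat) \<Rightarrow> (nat \<rightharpoonup> nat) \<Rightarrow> (nat \<rightharpoonup> nat)" where
  "subT_join f g k = (if even k then f (k div 2) else g (k div 2))"

definition subT_meet :: "(nat \<rightharpoonup> nat) \<Rightarrow> (nat \<rightharpoonup> nat) \<Rightarrow> (nat \<rightharpoonup> nat)" where
  "subT_meet f g k =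
     (let d = fst (prod_decode k);
          e = fst (prod_decode (snd (prod_decode k)));
          n = snd (prod_decode (snd (prod_decode k)))
      in if seq_comp (Phi d) f n = seq_comp (Phi e) g n then seq_comp (Phi d) f n else None)"

definition subT_equiv :: "((nat \<rightharpoonup> nat) \<times> (nat \<rightharpoonup> nat)) set" where
  "subT_equiv = {(f, g). f \<le>\<^sub>s\<^sub>u\<^sub>b\<^sub>T g \<and> g \<le>\<^sub>s\<^sub>u\<^sub>b\<^sub>T f}"

definition subT_degrees :: "(nat \<rightharpoonup> nat) set set" where
  "subT_degrees = UNIV // subT_equiv"

text \<open>
  Order and operations induced on the equivalence classes. They are independent of the choice of
  representatives, so the unions below are again single classes.
\<close>

definition degree_le :: "(nat \<rightharpoonup> nat) set \<Rightarrow> (nat \<rightharpoonup> nat) set \<Rightarrow> bool" where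
  "degree_le a b \<longleftrightarrow> (\<exists>f\<in>a. \<exists>g\<in>b. f \<le>\<^sub>s\<^sub>u\<^sub>b\<^sub>T g)"

definition degree_join :: "(nat \<rightharpoonup> nat) set \<Rightarrow> (nat \<rightharpoonup> nat) set \<Rightarrow> (nat \<rightharpoonup> nat) set" where
  "degree_join a b = (\<Union>f\<in>a. \<Union>g\<in>b. subT_equiv `` {subT_join f g})"

definition degree_meet :: "(nat \<rightharpoonup> nat) set \<Rightarrow> (nat \<rightharpoonup> nat) set \<Rightarrow> (nat \<rightharpoonup> nat) set" where
  "degree_meet a b = (\<Union>f\<in>a. \<Union>g\<in>b. subT_equiv `` {subT_meet f g})"

end

theory Submission
  imports Defs "HOL-Library.Countable"
begin

text \<open>
  The partial functions \<open>b\<close> and \<open>c\<close> contain infinitely many blocks \<open>(d, s, r, x)\<close> with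
  \<open>c d = s\<close>, \<open>b s = r\<close>, \<open>c r = x\<close> and \<open>b d = x\<close>, where the \<open>s\<close> are even and the \<open>d\<close> are odd;
  \<open>a\<close> is the restriction of \<open>b\<close> to even arguments. The map \<open>d \<mapsto> x\<close> is below \<open>b\<close>, and below
  \<open>a \<or> c\<close> by querying \<open>c\<close>, \<open>a\<close>, \<open>c\<close> alternately. It is not below \<open>a \<or> (b \<and> c)\<close>: given only \<open>d\<close>,
  \<open>b\<close> yields \<open>x\<close> but not \<open>s\<close>, whereas \<open>c\<close> yields \<open>s\<close> but not \<open>x\<close>, so their common part
  yields neither, and without \<open>s\<close> the function \<open>a\<close> is of no use.

  The blocks are chosen one by one, the \<open>n\<close>-th one defeating the \<open>n\<close>-th potential reduction.
  That a value is undefined is preserved by keeping a single query unanswered forever, so each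
  block imposes only finitely many restrictions on the later ones.
\<close>

section \<open>Partial functions\<close>

lemma map_leI: "(\<And>x y. f x = Some y \<Longrightarrow> g x = Some y) \<Longrightarrow> f \<subseteq>\<^sub>m g"
  by (fastforce simp: map_le_def)

lemma map_le_SomeD: "f \<subseteq>\<^sub>m g \<Longrightarrow> f x = Some y \<Longrightarrow> g x = Some y"
  by (metis domI map_le_def)

lemma map_le_fresh_upd: "f x = None \<Longrightarrow> f \<subseteq>\<^sub>m f(x \<mapsto> y)"
  by (auto simp: map_le_def)

lemma restrict_map_le: "f |` A \<subseteq>\<^sub>m f"
  by (simp add: map_le_def)

lemma restrict_map_mono: "f \<subseteq>\<^sub>m g \<Longrightarrow> f |` A \<subseteq>\<^sub>m g |` A"
  by (simp add: map_le_def)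

lemma case_sum_mono: "f \<subseteq>\<^sub>m f' \<Longrightarrow> g \<subseteq>\<^sub>m g' \<Longrightarrow> case_sum f g \<subseteq>\<^sub>m case_sum f' g'"
  by (rule map_leI) (auto dest: map_le_SomeD split: sum.splits)

definition map_inter :: "('a \<rightharpoonup> 'b) \<Rightarrow> ('a \<rightharpoonup> 'b) \<Rightarrow> ('a \<rightharpoonup> 'b)" (infixl "\<inter>\<^sub>m" 70) where
  "(f \<inter>\<^sub>m g) x = (if f x = g x then f x else None)"

lemma map_inter_eq_Some_iff [simp]: "(f \<inter>\<^sub>m g) x = Some y \<longleftrightarrow> f x = Some y \<and> g x = Some y"
  by (auto simp: map_inter_def)

lemma map_inter_eq_NoneI:
  "f x = None \<Longrightarrow> (f \<inter>\<^sub>m g) x = None"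
  "g x = None \<Longrightarrow> (f \<inter>\<^sub>m g) x = None"
  by (auto simp: map_inter_def)

lemma map_inter_le1: "f \<inter>\<^sub>m g \<subseteq>\<^sub>m f"
  by (rule map_leI) simp

lemma map_inter_le2: "f \<inter>\<^sub>m g \<subseteq>\<^sub>m g"
  by (rule map_leI) simp

lemma map_inter_mono: "f \<subseteq>\<^sub>m f' \<Longrightarrow> g \<subseteq>\<^sub>m g' \<Longrightarrow> f \<inter>\<^sub>m g \<subseteq>\<^sub>m f' \<inter>\<^sub>m g'"
  by (rule map_leI) (auto dest: map_le_SomeD)

lemma map_chain_le:
  assumes "\<And>n. u n \<subseteq>\<^sub>m u (Suc n)" and "m \<le> n"
  shows "u m \<subseteq>\<^sub>m u n"
  using assms(2) by (induction rule: dec_induct) (auto intro: map_le_trans assms(1))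

lemma map_chain_limit:
  fixes u :: "nat \<Rightarrow> 'a \<rightharpoonup> 'b"
  assumes chain: "\<And>n. u n \<subseteq>\<^sub>m u (Suc n)"
  obtains w where "\<And>n. u n \<subseteq>\<^sub>m w" "dom w = (\<Union>n. dom (u n))"
proof
  define w where "w x = u (SOME n. x \<in> dom (u n)) x" for x
  show le: "u n \<subseteq>\<^sub>m w" for n
  proof (rule map_leI)
    fix x y assume y: "u n x = Some y"
    define m where "m = (SOME m. x \<in> dom (u m))"
    have "x \<in> dom (u m)"
      unfolding m_def using y by (intro someI[of "\<lambda>m. x \<in> dom (u m)"]) (rule domI)
    then obtain z where z: "u m x = Some z" by blast
    have "u m \<subseteq>\<^sub>m u (max m n)" "u n \<subseteq>\<^sub>m u (max m n)"
      by (simp_all add: map_chain_le[of u, OF chain])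
    with y z have "y = z" by (metis map_le_SomeD option.inject)
    with z show "w x = Some y" by (simp add: w_def m_def)
  qed
  have "dom w \<subseteq> (\<Union>n. dom (u n))" unfolding w_def by blast
  with le show "dom w = (\<Union>n. dom (u n))" by (auto dest: map_le_SomeD)
qed

section \<open>Finite conditions\<close>

text \<open>A condition answers the queries in \<^term>\<open>dom u\<close> and keeps those in \<open>Z\<close> unanswered.\<close>

definition condition :: "('q \<rightharpoonup> 'r) \<Rightarrow> 'q set \<Rightarrow> bool" where
  "condition u Z \<longleftrightarrow> finite (dom u) \<and> finite Z \<and> Z \<inter> dom u = {}"

definition forces :: "('q \<rightharpoonup> 'r) \<Rightarrow> 'q set \<Rightarrow> (('q \<rightharpoonup> 'r) \<Rightarrow> bool) \<Rightarrow> bool" where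
  "forces u Z \<phi> \<longleftrightarrow> (\<forall>w. u \<subseteq>\<^sub>m w \<longrightarrow> Z \<inter> dom w = {} \<longrightarrow> \<phi> w)"

lemma forcesI: "(\<And>w. u \<subseteq>\<^sub>m w \<Longrightarrow> Z \<inter> dom w = {} \<Longrightarrow> \<phi> w) \<Longrightarrow> forces u Z \<phi>"
  by (simp add: forces_def)

lemma forcesD: "forces u Z \<phi> \<Longrightarrow> u \<subseteq>\<^sub>m w \<Longrightarrow> Z \<inter> dom w = {} \<Longrightarrow> \<phi> w"
  by (simp add: forces_def)

lemma forces_chain_limit:
  assumes chain: "\<And>n. u n \<subseteq>\<^sub>m u (Suc n)" "\<And>n. Z n \<subseteq> Z (Suc n)"
    and disjoint: "\<And>n. Z n \<inter> dom (u n) = {}"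
    and forces: "\<And>n. forces (u (Suc n)) (Z (Suc n)) (\<phi> n)"
  shows "\<exists>w. \<forall>n. \<phi> n w"
proof -
  obtain w where above: "\<And>n. u n \<subseteq>\<^sub>m w" and dom_w: "dom w = (\<Union>n. dom (u n))"
    using map_chain_limit[of u, OF chain(1)] by blast
  have "Z m \<inter> dom (u n) = {}" for m n
  proof -
    have "Z m \<subseteq> Z (max m n)"
      by (rule lift_Suc_mono_le[of Z, OF chain(2)]) simp
    moreover have "dom (u n) \<subseteq> dom (u (max m n))"
      by (intro map_le_implies_dom_le map_chain_le[of u, OF chain(1)]) simp
    ultimately show ?thesis using disjoint[of "max m n"] by blast
  qed
  then have "Z m \<inter> dom w = {}" for m using dom_w by blast
  then have "\<phi> n w" for n using forcesD[OF forces above] by blast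
  then show ?thesis by blast
qed

lemma ex_generic:
  fixes \<phi> :: "'i::countable \<Rightarrow> ('q \<rightharpoonup> 'r) \<Rightarrow> bool"
  assumes dense: "\<And>i u Z. condition u Z \<Longrightarrow>
    \<exists>u' Z'. condition u' Z' \<and> u \<subseteq>\<^sub>m u' \<and> Z \<subseteq> Z' \<and> forces u' Z' (\<phi> i)"
  shows "\<exists>w. \<forall>i. \<phi> i w"
proof -
  define extend where "extend n p p' \<longleftrightarrow> fst p \<subseteq>\<^sub>m fst p' \<and> snd p \<subseteq> snd p' \<and>
    forces (fst p') (snd p') (\<phi> (from_nat n))" for n p p'
  have "\<exists>p. condition (fst p) (snd p :: 'q set)"
    by (rule exI[of _ "(Map.empty, {})"]) (simp add: condition_def)
  moreover have "\<exists>p'. condition (fst p') (snd p') \<and> extend n p p'"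
    if "condition (fst p) (snd p)" for p n
    using dense[OF that, of "from_nat n"] by (simp add: extend_def)
  ultimately obtain p where p: "\<And>n. condition (fst (p n)) (snd (p n))"
      "\<And>n. extend n (p n) (p (Suc n))"
    using dependent_nat_choice[of "\<lambda>_ p. condition (fst p) (snd p)" extend] by metis
  have "\<exists>w. \<forall>n. \<phi> (from_nat n) w"
    using p by (intro forces_chain_limit[of "fst \<circ> p" "snd \<circ> p"])
      (auto simp: condition_def extend_def)
  then show ?thesis by (metis from_nat_to_nat)
qed

section \<open>Sequential functionals\<close>

text \<open>
  If \<open>T\<close> is undefined at an oracle but can be made defined by extending it, then a single query
  \<open>q\<close> has to be answered first. Unlike continuity, this implies stability.
\<close>

definition sequential :: "(('q \<rightharpoonup> 'r) \<Rightarrow> 'v option) \<Rightarrow> bool" where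
  "sequential T \<longleftrightarrow>
     (\<forall>u w v. u \<subseteq>\<^sub>m w \<longrightarrow> T u = Some v \<longrightarrow> T w = Some v) \<and>
     (\<forall>u w v. u \<subseteq>\<^sub>m w \<longrightarrow> T u = None \<longrightarrow> T w = Some v \<longrightarrow>
        (\<exists>q. u q = None \<and> forces u {q} (\<lambda>w. T w = None)))"

lemma sequentialI:
  assumes "\<And>u w v. u \<subseteq>\<^sub>m w \<Longrightarrow> T u = Some v \<Longrightarrow> T w = Some v"
    and "\<And>u w v. u \<subseteq>\<^sub>m w \<Longrightarrow> T u = None \<Longrightarrow> T w = Some v \<Longrightarrow>
      \<exists>q. u q = None \<and> forces u {q} (\<lambda>w. T w = None)"
  shows "sequential T"
  using assms unfolding sequential_def by blast

lemma sequential_mono: "sequential T \<Longrightarrow> u \<subseteq>\<^sub>m w \<Longrightarrow> T u = Some v \<Longrightarrow> T w = Some v"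
  unfolding sequential_def by blast

lemma sequential_blocking_query:
  assumes "sequential T" "u \<subseteq>\<^sub>m w" "T u = None" "T w = Some v"
  shows "\<exists>q. u q = None \<and> forces u {q} (\<lambda>w. T w = None)"
  using assms unfolding sequential_def by blast

lemma sequential_stable:
  assumes T: "sequential T" and bounded: "u\<^sub>1 \<subseteq>\<^sub>m w" "u\<^sub>2 \<subseteq>\<^sub>m w"
    and outputs: "T u\<^sub>1 = Some v" "T u\<^sub>2 = Some v"
  shows "T (u\<^sub>1 \<inter>\<^sub>m u\<^sub>2) = Some v"
proof (cases "T (u\<^sub>1 \<inter>\<^sub>m u\<^sub>2)")
  case None
  then obtain q where q: "(u\<^sub>1 \<inter>\<^sub>m u\<^sub>2) q = None" "forces (u\<^sub>1 \<inter>\<^sub>m u\<^sub>2) {q} (\<lambda>w. T w = None)"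
    using sequential_blocking_query[OF T map_inter_le1 _ outputs(1)] by blast
  have "u\<^sub>1 q \<noteq> None"
    using forcesD[OF q(2) map_inter_le1] outputs(1) by auto
  moreover have "u\<^sub>2 q \<noteq> None"
    using forcesD[OF q(2) map_inter_le2] outputs(2) by auto
  ultimately have "u\<^sub>1 q = w q" "u\<^sub>2 q = w q"
    using bounded by (auto simp: map_le_def domIff)
  with q(1) \<open>u\<^sub>1 q \<noteq> None\<close> show ?thesis by (simp add: map_inter_def)
next
  case (Some v')
  then show ?thesis using sequential_mono[OF T map_inter_le1 Some] outputs(1) by simp
qed

lemma sequential_avoid_value:
  assumes T: "sequential T" and avoid: "T u \<noteq> Some v"
  obtains S where "finite S" "S \<inter> dom u = {}" "forces u S (\<lambda>w. T w \<noteq> Some v)"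
proof (cases "\<exists>w. u \<subseteq>\<^sub>m w \<and> T w = Some v")
  case True
  then obtain w where w: "u \<subseteq>\<^sub>m w" "T w = Some v" by blast
  then have "T u = None"
    using avoid sequential_mono[OF T w(1)] by (cases "T u") auto
  then obtain q where "u q = None" "forces u {q} (\<lambda>w. T w = None)"
    using sequential_blocking_query[OF T w(1) _ w(2)] by blast
  then show thesis by (intro that[of "{q}"]) (auto simp: forces_def)
next
  case False
  then show thesis by (intro that[of "{}"]) (auto simp: forces_def)
qed

lemma sequential_avoid_value_upd:
  assumes "sequential T" "T u \<noteq> Some v" "finite (dom u)"
  obtains S where "finite S" "\<And>q r. q \<notin> S \<Longrightarrow> T (u(q \<mapsto> r)) \<noteq> Some v"
proof -
  obtain S where S: "finite S" "S \<inter> dom u = {}" "forces u S (\<lambda>w. T w \<noteq> Some v)"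
    using sequential_avoid_value[OF assms(1,2)] by blast
  have "T (u(q \<mapsto> r)) \<noteq> Some v" if "q \<notin> S \<union> dom u" for q r
    using that S(2) by (intro forcesD[OF S(3)] map_le_fresh_upd) auto
  with S(1) assms(3) show thesis by (intro that[of "S \<union> dom u"]) auto
qed

definition sequential_op :: "(('q \<rightharpoonup> 'r) \<Rightarrow> ('p \<rightharpoonup> 's)) \<Rightarrow> bool" where
  "sequential_op \<Phi> \<longleftrightarrow> (\<forall>n. sequential (\<lambda>u. \<Phi> u n))"

lemma sequential_opI: "(\<And>n. sequential (\<lambda>u. \<Phi> u n)) \<Longrightarrow> sequential_op \<Phi>"
  by (simp add: sequential_op_def)

lemma sequential_opD: "sequential_op \<Phi> \<Longrightarrow> sequential (\<lambda>u. \<Phi> u n)"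
  by (simp add: sequential_op_def)

lemma sequential_op_mono: "sequential_op \<Phi> \<Longrightarrow> u \<subseteq>\<^sub>m w \<Longrightarrow> \<Phi> u \<subseteq>\<^sub>m \<Phi> w"
  unfolding sequential_op_def sequential_def by (blast intro: map_leI)

lemma sequential_comp:
  assumes T: "sequential T" and \<Phi>: "sequential_op \<Phi>"
  shows "sequential (\<lambda>u. T (\<Phi> u))"
proof (rule sequentialI)
  fix u w v assume "u \<subseteq>\<^sub>m w" "T (\<Phi> u) = Some v"
  then show "T (\<Phi> w) = Some v" by (rule sequential_mono[OF T sequential_op_mono[OF \<Phi>]])
next
  fix u w v assume le: "u \<subseteq>\<^sub>m w" and undefined: "T (\<Phi> u) = None" and defined: "T (\<Phi> w) = Some v"
  note \<Phi>_le = sequential_op_mono[OF \<Phi>]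
  obtain p where p: "\<Phi> u p = None" "forces (\<Phi> u) {p} (\<lambda>w. T w = None)"
    using sequential_blocking_query[OF T \<Phi>_le[OF le] undefined defined] by blast
  have "\<Phi> w p \<noteq> None"
    using forcesD[OF p(2) \<Phi>_le[OF le]] defined by auto
  then obtain a where "\<Phi> w p = Some a" by blast
  then obtain q where q: "u q = None" "forces u {q} (\<lambda>w. \<Phi> w p = None)"
    using sequential_blocking_query[OF sequential_opD[OF \<Phi>] le p(1)] by blast
  have "forces u {q} (\<lambda>w. T (\<Phi> w) = None)"
  proof (rule forcesI)
    fix w assume w: "u \<subseteq>\<^sub>m w" "{q} \<inter> dom w = {}"
    from forcesD[OF q(2) this] have "{p} \<inter> dom (\<Phi> w) = {}" by (simp add: domIff)
    then show "T (\<Phi> w) = None" by (rule forcesD[OF p(2) \<Phi>_le[OF w(1)]])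
  qed
  with q(1) show "\<exists>q. u q = None \<and> forces u {q} (\<lambda>w. T (\<Phi> w) = None)" by blast
qed

lemma sequential_op_comp:
  assumes "sequential_op \<Psi>" "sequential_op \<Phi>"
  shows "sequential_op (\<lambda>u. \<Psi> (\<Phi> u))"
proof (rule sequential_opI)
  show "sequential (\<lambda>u. \<Psi> (\<Phi> u) n)" for n
    using sequential_comp[of "\<lambda>u. \<Psi> u n" \<Phi>] assms by (simp add: sequential_opD)
qed

lemma sequential_const: "sequential (\<lambda>u. y)"
  by (auto intro: sequentialI)

lemma sequential_query: "sequential (\<lambda>u. u q)"
  by (rule sequentialI) (auto simp: forces_def dest: map_le_SomeD)

lemma sequential_op_const: "sequential_op (\<lambda>u. f)"
  by (intro sequential_opI sequential_const)

lemma sequential_op_id: "sequential_op (\<lambda>u. u)"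
  by (intro sequential_opI sequential_query)

lemma sequential_op_reindex: "sequential_op \<Phi> \<Longrightarrow> sequential_op (\<lambda>u. \<Phi> u \<circ> h)"
  by (simp add: sequential_op_def)

lemma sequential_op_restrict:
  assumes "sequential_op \<Phi>"
  shows "sequential_op (\<lambda>u. \<Phi> u |` A)"
proof (rule sequential_opI)
  show "sequential (\<lambda>u. (\<Phi> u |` A) n)" for n
    using assms by (cases "n \<in> A") (simp_all add: sequential_opD sequential_const)
qed

lemma sequential_op_case_sum:
  assumes "sequential_op \<Phi>" "sequential_op \<Psi>"
  shows "sequential_op (\<lambda>u. case_sum (\<Phi> u) (\<Psi> u))"
proof (rule sequential_opI)
  show "sequential (\<lambda>u. case_sum (\<Phi> u) (\<Psi> u) n)" for n
    using assms by (cases n) (simp_all add: sequential_opD)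
qed

lemma sequential_op_map_inter:
  assumes \<Phi>: "sequential_op \<Phi>" and \<Psi>: "sequential_op \<Psi>"
  shows "sequential_op (\<lambda>u. \<Phi> u \<inter>\<^sub>m \<Psi> u)"
proof (intro sequential_opI sequentialI)
  fix n u w v assume le: "u \<subseteq>\<^sub>m w" and value_u: "(\<Phi> u \<inter>\<^sub>m \<Psi> u) n = Some v"
  have "\<Phi> u \<inter>\<^sub>m \<Psi> u \<subseteq>\<^sub>m \<Phi> w \<inter>\<^sub>m \<Psi> w"
    by (intro map_inter_mono sequential_op_mono[OF \<Phi> le] sequential_op_mono[OF \<Psi> le])
  then show "(\<Phi> w \<inter>\<^sub>m \<Psi> w) n = Some v" using value_u by (rule map_le_SomeD)
next
  fix n u w v
  assume le: "u \<subseteq>\<^sub>m w" and undefined: "(\<Phi> u \<inter>\<^sub>m \<Psi> u) n = None"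
    and "(\<Phi> w \<inter>\<^sub>m \<Psi> w) n = Some v"
  then have w: "\<Phi> w n = Some v" "\<Psi> w n = Some v" by simp_all
  have "\<Phi> u n = Some v" if "\<Phi> u n \<noteq> None"
    using that w(1) map_le_SomeD[OF sequential_op_mono[OF \<Phi> le]] by fastforce
  moreover have "\<Psi> u n = Some v" if "\<Psi> u n \<noteq> None"
    using that w(2) map_le_SomeD[OF sequential_op_mono[OF \<Psi> le]] by fastforce
  ultimately consider (left) "\<Phi> u n = None" | (right) "\<Psi> u n = None"
    using undefined by (force simp: map_inter_def)
  then show "\<exists>q. u q = None \<and> forces u {q} (\<lambda>w. (\<Phi> w \<inter>\<^sub>m \<Psi> w) n = None)"
  proof cases
    case left
    then obtain q where "u q = None" "forces u {q} (\<lambda>w. \<Phi> w n = None)"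
      using sequential_blocking_query[OF sequential_opD[OF \<Phi>] le _ w(1)] by blast
    then show ?thesis by (auto simp: forces_def intro: map_inter_eq_NoneI)
  next
    case right
    then obtain q where "u q = None" "forces u {q} (\<lambda>w. \<Psi> w n = None)"
      using sequential_blocking_query[OF sequential_opD[OF \<Psi>] le _ w(2)] by blast
    then show ?thesis by (auto simp: forces_def intro: map_inter_eq_NoneI)
  qed
qed

section \<open>Defeating a countable family of reductions\<close>

lemma ex_mem_infinite_diff_finite: "infinite A \<Longrightarrow> finite B \<Longrightarrow> \<exists>x. x \<in> A - B"
  using infinite_imp_nonempty[OF Diff_infinite_finite] by blast

definition block ::
    "'a set \<Rightarrow> ('a \<rightharpoonup> 'a) \<Rightarrow> ('a \<rightharpoonup> 'a) \<Rightarrow> 'a \<Rightarrow> 'a \<Rightarrow> 'a \<Rightarrow> 'a \<Rightarrow> bool" where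
  "block E b c d s r x \<longleftrightarrow>
     d \<notin> E \<and> s \<in> E \<and> c d = Some s \<and> b s = Some r \<and> c r = Some x \<and> b d = Some x"

lemma block_mono: "b \<subseteq>\<^sub>m b' \<Longrightarrow> c \<subseteq>\<^sub>m c' \<Longrightarrow> block E b c d s r x \<Longrightarrow> block E b' c' d s r x"
  by (auto simp: block_def dest: map_le_SomeD)

text \<open>
  \<open>E\<close> stands for the set of even numbers, so \<open>b |` E\<close> is \<open>a\<close>; \<open>L b\<close> and \<open>N c\<close> are the two
  computations whose values have to agree for \<open>b \<and> c\<close> to be defined.
\<close>

definition candidate_oracle ::
    "'a set \<Rightarrow> (('a \<rightharpoonup> 'a) \<Rightarrow> 'k \<rightharpoonup> 'a) \<Rightarrow> (('a \<rightharpoonup> 'a) \<Rightarrow> 'k \<rightharpoonup> 'a) \<Rightarrow>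
     ('a \<rightharpoonup> 'a) \<Rightarrow> ('a \<rightharpoonup> 'a) \<Rightarrow> 'a + 'k \<rightharpoonup> 'a" where
  "candidate_oracle E L N b c = case_sum (b |` E) (L b \<inter>\<^sub>m N c)"

lemma sequential_candidate:
  assumes "sequential T" "sequential_op L" "sequential_op N"
  shows "sequential (\<lambda>u. T (candidate_oracle E L N (u \<circ> Inl) (u \<circ> Inr)))"
  unfolding candidate_oracle_def
  by (intro sequential_comp[OF assms(1)] sequential_op_case_sum sequential_op_restrict
      sequential_op_map_inter sequential_op_comp[OF assms(2)] sequential_op_comp[OF assms(3)]
      sequential_op_reindex sequential_op_id)

lemma candidate_oracle_le_left: "candidate_oracle E L N b c \<subseteq>\<^sub>m case_sum (b |` E) (L b)"
  unfolding candidate_oracle_def by (intro case_sum_mono map_le_refl map_inter_le1)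

lemma case_sum_inter_candidate_oracle_le:
  "case_sum f g \<inter>\<^sub>m candidate_oracle E L N b c \<subseteq>\<^sub>m case_sum f (N c)"
proof (rule map_leI)
  show "case_sum f (N c) p = Some y" if "(case_sum f g \<inter>\<^sub>m candidate_oracle E L N b c) p = Some y"
    for p y
    using that by (cases p) (simp_all add: candidate_oracle_def)
qed

lemma candidate_avoids_left:
  assumes T: "sequential T" and L: "sequential_op L"
    and E: "infinite E" and F: "finite F" "dom b \<subseteq> F" and d: "d \<notin> E"
    and left_fails: "T (case_sum (b |` E) (L (b(d \<mapsto> x)))) \<noteq> Some x"
  obtains s where "s \<in> E - F" "\<And>r c. T (candidate_oracle E L N (b(d \<mapsto> x, s \<mapsto> r)) c) \<noteq> Some x"
proof -
  define left where "left b' = T (case_sum (b' |` E) (L b'))" for b'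
  have seq_left: "sequential left"
    unfolding left_def
    by (intro sequential_comp[OF T] sequential_op_case_sum sequential_op_restrict L
        sequential_op_id)
  have "left (b(d \<mapsto> x)) \<noteq> Some x" using left_fails d by (simp add: left_def)
  moreover have "finite (dom (b(d \<mapsto> x)))" using F by (simp add: finite_subset)
  ultimately obtain S where S: "finite S" "\<And>s r. s \<notin> S \<Longrightarrow> left (b(d \<mapsto> x, s \<mapsto> r)) \<noteq> Some x"
    using sequential_avoid_value_upd[OF seq_left] by blast
  obtain s where s: "s \<in> E - (F \<union> S)"
    using ex_mem_infinite_diff_finite[OF E finite_UnI[OF F(1) S(1)]] by blast
  have "T (candidate_oracle E L N (b(d \<mapsto> x, s \<mapsto> r)) c) \<noteq> Some x" for r c
    using sequential_mono[OF T candidate_oracle_le_left] S(2)[of s r] s unfolding left_def by blast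
  with s show thesis by (intro that[of s]) auto
qed

text \<open>
  If \<open>b\<close> computes \<open>x\<close> without the pair \<open>(s, r)\<close>, then by stability a computation of \<open>x\<close> from
  \<open>a \<or> (b \<and> c)\<close> ignores that pair as well.
\<close>

lemma candidate_value_imp_right_value:
  assumes T: "sequential T" and L: "sequential_op L"
    and d: "d \<notin> E" and s: "s \<notin> insert d (dom b)"
    and left_value: "T (case_sum (b |` E) (L (b(d \<mapsto> x)))) = Some v"
    and candidate_value: "T (candidate_oracle E L N (b(d \<mapsto> x, s \<mapsto> r)) c) = Some v"
  shows "T (case_sum (b |` E) (N c)) = Some v"
proof -
  define b' where "b' = b(d \<mapsto> x, s \<mapsto> r)"
  have b_le: "b(d \<mapsto> x) \<subseteq>\<^sub>m b'"
    unfolding b'_def using s by (intro map_le_fresh_upd) auto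
  have "b |` E \<subseteq>\<^sub>m b' |` E" using restrict_map_mono[OF b_le, of E] d by simp
  then have "case_sum (b |` E) (L (b(d \<mapsto> x))) \<subseteq>\<^sub>m case_sum (b' |` E) (L b')"
    by (intro case_sum_mono sequential_op_mono[OF L b_le])
  then have "T (case_sum (b |` E) (L (b(d \<mapsto> x))) \<inter>\<^sub>m candidate_oracle E L N b' c) = Some v"
    using left_value candidate_value[folded b'_def] candidate_oracle_le_left
    by (intro sequential_stable[OF T])
  then show ?thesis
    by (rule sequential_mono[OF T case_sum_inter_candidate_oracle_le])
qed

text \<open>
  When \<open>x\<close> is chosen, \<open>c\<close> knows \<open>s\<close> but not yet \<open>r\<close>, so \<open>x\<close> can differ from the value it yields.
\<close>

lemma candidate_avoids_right:
  assumes T: "sequential T" and L: "sequential_op L" and N: "sequential_op N"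
    and E: "infinite E" and F: "finite F" "dom b \<subseteq> F" "dom c \<subseteq> F" and d: "d \<notin> E"
    and s: "s \<notin> insert d F"
    and left_succeeds: "\<And>x. T (case_sum (b |` E) (L (b(d \<mapsto> x)))) = Some x"
  obtains r x where "r \<in> E - F"
    "T (candidate_oracle E L N (b(d \<mapsto> x, s \<mapsto> r)) (c(d \<mapsto> s, r \<mapsto> x))) \<noteq> Some x"
proof -
  define right where "right c' = T (case_sum (b |` E) (N c'))" for c'
  have seq_right: "sequential right"
    unfolding right_def
    by (intro sequential_comp[OF T] sequential_op_case_sum sequential_op_const N)
  obtain x where "x \<in> E - {the (right (c(d \<mapsto> s)))}"
    using ex_mem_infinite_diff_finite[OF E, of "{the (right (c(d \<mapsto> s)))}"] by auto
  then have "right (c(d \<mapsto> s)) \<noteq> Some x" by auto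
  moreover have "finite (dom (c(d \<mapsto> s)))" using F by (simp add: finite_subset)
  ultimately obtain S where S: "finite S" "\<And>r y. r \<notin> S \<Longrightarrow> right (c(d \<mapsto> s, r \<mapsto> y)) \<noteq> Some x"
    using sequential_avoid_value_upd[OF seq_right] by blast
  obtain r where r: "r \<in> E - (F \<union> S)"
    using ex_mem_infinite_diff_finite[OF E finite_UnI[OF F(1) S(1)]] by blast
  have "T (candidate_oracle E L N (b(d \<mapsto> x, s \<mapsto> r)) (c(d \<mapsto> s, r \<mapsto> x))) \<noteq> Some x"
  proof
    assume "T (candidate_oracle E L N (b(d \<mapsto> x, s \<mapsto> r)) (c(d \<mapsto> s, r \<mapsto> x))) = Some x"
    moreover have "s \<notin> insert d (dom b)" using s F(2) by blast
    ultimately have "T (case_sum (b |` E) (N (c(d \<mapsto> s, r \<mapsto> x)))) = Some x"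
      by (intro candidate_value_imp_right_value[OF T L d _ left_succeeds])
    moreover have "right (c(d \<mapsto> s, r \<mapsto> x)) \<noteq> Some x" using S(2) r by blast
    ultimately show False by (simp add: right_def)
  qed
  with r show thesis by (intro that[of r x]) auto
qed

lemma ex_block_avoiding_candidate:
  fixes b c :: "'a \<rightharpoonup> 'a"
  assumes seq: "\<And>d. sequential (T d)" "sequential_op L" "sequential_op N"
    and E: "infinite E" "infinite (- E)" and F: "finite F" "dom b \<subseteq> F" "dom c \<subseteq> F"
  obtains d s r x where "d \<in> - E - F" "s \<in> E - F" "r \<in> E - F"
    "T d (candidate_oracle E L N (b(d \<mapsto> x, s \<mapsto> r)) (c(d \<mapsto> s, r \<mapsto> x))) \<noteq> Some x"
proof -
  obtain d where d: "d \<notin> E" "d \<notin> F"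
    using ex_mem_infinite_diff_finite[OF E(2) F(1)] by blast
  show thesis
  proof (cases "\<exists>x. T d (case_sum (b |` E) (L (b(d \<mapsto> x)))) \<noteq> Some x")
    case True
    then obtain x where left_fails: "T d (case_sum (b |` E) (L (b(d \<mapsto> x)))) \<noteq> Some x" by blast
    obtain s where "s \<in> E - F"
      "\<And>r c. T d (candidate_oracle E L N (b(d \<mapsto> x, s \<mapsto> r)) c) \<noteq> Some x"
      by (rule candidate_avoids_left[OF seq(1,2) E(1) F(1,2) d(1) left_fails, where N = N]) blast
    with d show thesis by (intro that[of d s s x]) auto
  next
    case False
    then have left_succeeds: "T d (case_sum (b |` E) (L (b(d \<mapsto> x)))) = Some x" for x by blast
    obtain s where s: "s \<in> E - F"
      using ex_mem_infinite_diff_finite[OF E(1) F(1)] by blast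
    with d have s_fresh: "s \<notin> insert d F" by auto
    obtain r x where "r \<in> E - F"
      "T d (candidate_oracle E L N (b(d \<mapsto> x, s \<mapsto> r)) (c(d \<mapsto> s, r \<mapsto> x))) \<noteq> Some x"
      by (rule candidate_avoids_right[OF seq E(1) F d(1) s_fresh left_succeeds])
    with d s show thesis by (intro that[of d s r x]) auto
  qed
qed

lemma condition_extends_to_block:
  fixes u :: "'a + 'a \<rightharpoonup> 'a"
  assumes seq: "\<And>d. sequential (T d)" "sequential_op L" "sequential_op N"
    and E: "infinite E" "infinite (- E)" and u: "condition u Z"
  shows "\<exists>u' Z'. condition u' Z' \<and> u \<subseteq>\<^sub>m u' \<and> Z \<subseteq> Z' \<and>
    forces u' Z' (\<lambda>w. \<exists>d s r x. block E (w \<circ> Inl) (w \<circ> Inr) d s r x \<and>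
      T d (candidate_oracle E L N (w \<circ> Inl) (w \<circ> Inr)) \<noteq> Some x)"
proof -
  define F where "F = Inl -` (dom u \<union> Z) \<union> Inr -` (dom u \<union> Z)"
  have "finite F" using u unfolding F_def condition_def by (intro finite_UnI finite_vimageI) auto
  moreover have "dom (u \<circ> Inl) \<subseteq> F" "dom (u \<circ> Inr) \<subseteq> F" by (auto simp: F_def)
  ultimately obtain d s r x where block: "d \<in> - E - F" "s \<in> E - F" "r \<in> E - F"
    and avoid: "T d (candidate_oracle E L N ((u \<circ> Inl)(d \<mapsto> x, s \<mapsto> r)) ((u \<circ> Inr)(d \<mapsto> s, r \<mapsto> x)))
      \<noteq> Some x"
    by (rule ex_block_avoiding_candidate[where T = T, OF seq E])
  define u' where "u' = u(Inl d \<mapsto> x, Inl s \<mapsto> r, Inr d \<mapsto> s, Inr r \<mapsto> x)"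
  have sections: "u' \<circ> Inl = (u \<circ> Inl)(d \<mapsto> x, s \<mapsto> r)" "u' \<circ> Inr = (u \<circ> Inr)(d \<mapsto> s, r \<mapsto> x)"
    by (auto simp: u'_def)
  have le: "u \<subseteq>\<^sub>m u'" using block by (auto simp: u'_def F_def map_le_def)
  have block_u': "block E (u' \<circ> Inl) (u' \<circ> Inr) d s r x"
    using block by (auto simp: block_def sections)
  let ?T = "\<lambda>w. T d (candidate_oracle E L N (w \<circ> Inl) (w \<circ> Inr))"
  have seq_T: "sequential ?T" by (rule sequential_candidate[OF seq])
  have avoid_u': "?T u' \<noteq> Some x" using avoid by (simp only: sections not_False_eq_True)
  obtain S where S: "finite S" "S \<inter> dom u' = {}" "forces u' S (\<lambda>w. ?T w \<noteq> Some x)"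
    by (rule sequential_avoid_value[of ?T u' x, OF seq_T avoid_u'])
  have "condition u' (Z \<union> S)"
    using u block S(1,2) by (auto simp: condition_def u'_def F_def)
  moreover have "block E (w \<circ> Inl) (w \<circ> Inr) d s r x" if "u' \<subseteq>\<^sub>m w" for w
    using block_u' by (rule block_mono[rotated 2]) (use that in \<open>auto simp: map_le_def\<close>)
  with S(3) have "forces u' (Z \<union> S) (\<lambda>w. block E (w \<circ> Inl) (w \<circ> Inr) d s r x \<and>
      T d (candidate_oracle E L N (w \<circ> Inl) (w \<circ> Inr)) \<noteq> Some x)"
    by (auto simp: forces_def)
  then have "forces u' (Z \<union> S) (\<lambda>w. \<exists>d s r x. block E (w \<circ> Inl) (w \<circ> Inr) d s r x \<and>
      T d (candidate_oracle E L N (w \<circ> Inl) (w \<circ> Inr)) \<noteq> Some x)"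
    unfolding forces_def by blast
  ultimately show ?thesis using le by blast
qed

lemma ex_blocks_avoiding_candidates:
  fixes T :: "'i::countable \<Rightarrow> 'a \<Rightarrow> ('a + 'k \<rightharpoonup> 'a) \<Rightarrow> 'a option"
  assumes "\<And>i d. sequential (T i d)" "\<And>i. sequential_op (L i)" "\<And>i. sequential_op (N i)"
    and "infinite E" "infinite (- E)"
  shows "\<exists>b c. \<forall>i. \<exists>d s r x. block E b c d s r x \<and>
    T i d (candidate_oracle E (L i) (N i) b c) \<noteq> Some x"
proof -
  have "\<exists>w :: 'a + 'a \<rightharpoonup> 'a. \<forall>i. \<exists>d s r x. block E (w \<circ> Inl) (w \<circ> Inr) d s r x \<and>
      T i d (candidate_oracle E (L i) (N i) (w \<circ> Inl) (w \<circ> Inr)) \<noteq> Some x"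
    by (intro ex_generic condition_extends_to_block assms)
  then show ?thesis by blast
qed

section \<open>Sequential computations\<close>

inductive halts :: "(nat list \<rightharpoonup> nat \<times> nat) \<Rightarrow> (nat \<rightharpoonup> nat) \<Rightarrow> nat list \<Rightarrow> nat \<Rightarrow> bool"
  for F g where
  Halt: "F \<sigma> = Some (1, v) \<Longrightarrow> halts F g \<sigma> v"
| Query: "F \<sigma> = Some (i, q) \<Longrightarrow> i \<noteq> 1 \<Longrightarrow> g q = Some a \<Longrightarrow> halts F g (\<sigma> @ [a]) v \<Longrightarrow> halts F g \<sigma> v"

lemma run_eq_Some_iff: "run F g \<sigma> = Some v \<longleftrightarrow> halts F g \<sigma> v"
proof
  show "halts F g \<sigma> v" if "run F g \<sigma> = Some v"
    using _ that
  proof (rule run.raw_induct)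
    fix rec F g \<sigma> v
    assume "\<And>F g \<sigma> v. rec F g \<sigma> = Some v \<Longrightarrow> halts F g \<sigma> v"
      and "Option.bind (F \<sigma>) (\<lambda>(i, q). if i = 1 then Some q
        else Option.bind (g q) (\<lambda>a. rec F g (\<sigma> @ [a]))) = Some v"
    then show "halts F g \<sigma> v"
      by (auto simp: bind_eq_Some_conv split: if_splits intro: halts.intros)
  qed
  show "run F g \<sigma> = Some v" if "halts F g \<sigma> v"
    using that by induction (auto simp: run.simps)
qed

lemma halts_mono: "halts F g \<sigma> v \<Longrightarrow> g \<subseteq>\<^sub>m g' \<Longrightarrow> halts F g' \<sigma> v"
  by (induction rule: halts.induct) (auto intro: halts.intros dest: map_le_SomeD)

lemma sequential_run: "sequential (\<lambda>g. run F g \<sigma>)"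
proof (rule sequentialI)
  fix u w v assume "u \<subseteq>\<^sub>m w" "run F u \<sigma> = Some v"
  then show "run F w \<sigma> = Some v" unfolding run_eq_Some_iff by (blast intro: halts_mono)
next
  fix u w v assume le: "u \<subseteq>\<^sub>m w" and "run F u \<sigma> = None" "run F w \<sigma> = Some v"
  then have "halts F w \<sigma> v" by (simp add: run_eq_Some_iff)
  then show "\<exists>q. u q = None \<and> forces u {q} (\<lambda>w. run F w \<sigma> = None)"
    using \<open>run F u \<sigma> = None\<close>
  proof induction
    case (Halt \<sigma> v)
    then show ?case by (simp add: run.simps)
  next
    case (Query \<sigma> i q a v)
    have run_\<sigma>: "run F g \<sigma> = Option.bind (g q) (\<lambda>a. run F g (\<sigma> @ [a]))" for g
      using Query.hyps by (subst run.simps) simp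
    show ?case
    proof (cases "u q")
      case None
      then show ?thesis by (intro exI[of _ q]) (simp add: forces_def run_\<sigma> domIff)
    next
      case (Some a')
      with le Query.hyps have u_q: "u q = Some a" by (auto dest: map_le_SomeD)
      with Query.prems have "run F u (\<sigma> @ [a]) = None" by (simp add: run_\<sigma>)
      then obtain p where p: "u p = None" "forces u {p} (\<lambda>w. run F w (\<sigma> @ [a]) = None)"
        using Query.IH by blast
      have "run F w \<sigma> = run F w (\<sigma> @ [a])" if "u \<subseteq>\<^sub>m w" for w
        using map_le_SomeD[OF that u_q] by (simp add: run_\<sigma>)
      with p(2) have "forces u {p} (\<lambda>w. run F w \<sigma> = None)" by (simp add: forces_def)
      with p(1) show ?thesis by blast
    qed
  qed
qed

lemma sequential_op_seq_comp: "sequential_op (seq_comp F)"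
  by (simp add: sequential_op_def seq_comp_def sequential_run)

lemmas seq_comp_mono = sequential_op_mono[OF sequential_op_seq_comp]

lemma subT_join_eq_case_sum:
  "subT_join f g = case_sum f g \<circ> (\<lambda>k. if even k then Inl (k div 2) else Inr (k div 2))"
  by (auto simp: subT_join_def)

lemma sequential_op_subT_join:
  "sequential_op \<Phi> \<Longrightarrow> sequential_op \<Psi> \<Longrightarrow> sequential_op (\<lambda>u. subT_join (\<Phi> u) (\<Psi> u))"
  unfolding subT_join_eq_case_sum by (intro sequential_op_reindex sequential_op_case_sum)

lemma subT_join_mono: "f \<subseteq>\<^sub>m f' \<Longrightarrow> g \<subseteq>\<^sub>m g' \<Longrightarrow> subT_join f g \<subseteq>\<^sub>m subT_join f' g'"
  by (rule map_leI) (auto simp: subT_join_def split: if_splits dest: map_le_SomeD)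

definition meet_left :: "(nat \<rightharpoonup> nat) \<Rightarrow> nat \<rightharpoonup> nat" where
  "meet_left f k = seq_comp (Phi (fst (prod_decode k))) f (snd (prod_decode (snd (prod_decode k))))"

definition meet_right :: "(nat \<rightharpoonup> nat) \<Rightarrow> nat \<rightharpoonup> nat" where
  "meet_right g k = seq_comp (Phi (fst (prod_decode (snd (prod_decode k))))) g
     (snd (prod_decode (snd (prod_decode k))))"

lemma subT_meet_eq_map_inter: "subT_meet f g = meet_left f \<inter>\<^sub>m meet_right g"
  by (simp add: fun_eq_iff map_inter_def subT_meet_def meet_left_def meet_right_def Let_def)

lemma sequential_op_meet_left: "sequential_op meet_left"
  by (simp add: sequential_op_def meet_left_def sequential_opD[OF sequential_op_seq_comp])

lemma sequential_op_meet_right: "sequential_op meet_right"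
  by (simp add: sequential_op_def meet_right_def sequential_opD[OF sequential_op_seq_comp])

lemma subT_meet_mono: "f \<subseteq>\<^sub>m f' \<Longrightarrow> g \<subseteq>\<^sub>m g' \<Longrightarrow> subT_meet f g \<subseteq>\<^sub>m subT_meet f' g'"
  unfolding subT_meet_eq_map_inter
  by (intro map_inter_mono sequential_op_mono[OF sequential_op_meet_left]
      sequential_op_mono[OF sequential_op_meet_right])

type_synonym indices = "nat \<times> nat \<times> nat \<times> nat \<times> nat"

text \<open>
  The inner indices \<open>e\<^sub>1, \<dots>, e\<^sub>4\<close> absorb the choice of representatives of the degrees, so that
  transitivity of the reducibility and a universal machine are never needed.
\<close>

fun join_meet_computation ::
    "indices \<Rightarrow> (nat \<rightharpoonup> nat) \<Rightarrow> (nat \<rightharpoonup> nat) \<Rightarrow> (nat \<rightharpoonup> nat) \<Rightarrow> nat \<rightharpoonup> nat" where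
  "join_meet_computation (e\<^sub>0, e\<^sub>1, e\<^sub>2, e\<^sub>3, e\<^sub>4) a b c =
     seq_comp (Phi e\<^sub>0) (subT_join (seq_comp (Phi e\<^sub>1) a)
       (seq_comp (Phi e\<^sub>2) (subT_meet (seq_comp (Phi e\<^sub>3) b) (seq_comp (Phi e\<^sub>4) c))))"

lemma ex_blocks_avoiding_computations:
  fixes E :: "nat set"
  assumes "infinite E" "infinite (- E)"
  shows "\<exists>b c. \<forall>i. \<exists>d s r x. block E b c d s r x \<and>
    join_meet_computation i (b |` E) b c (h d) \<noteq> Some x"
proof -
  define T :: "indices \<Rightarrow> nat \<Rightarrow> (nat + nat \<rightharpoonup> nat) \<Rightarrow> nat option" where
    "T = (\<lambda>(e\<^sub>0, e\<^sub>1, e\<^sub>2, e\<^sub>3, e\<^sub>4) d u. seq_comp (Phi e\<^sub>0)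
      (subT_join (seq_comp (Phi e\<^sub>1) (u \<circ> Inl)) (seq_comp (Phi e\<^sub>2) (u \<circ> Inr))) (h d))"
  define L :: "indices \<Rightarrow> (nat \<rightharpoonup> nat) \<Rightarrow> nat \<rightharpoonup> nat" where
    "L = (\<lambda>(e\<^sub>0, e\<^sub>1, e\<^sub>2, e\<^sub>3, e\<^sub>4) b. meet_left (seq_comp (Phi e\<^sub>3) b))"
  define N :: "indices \<Rightarrow> (nat \<rightharpoonup> nat) \<Rightarrow> nat \<rightharpoonup> nat" where
    "N = (\<lambda>(e\<^sub>0, e\<^sub>1, e\<^sub>2, e\<^sub>3, e\<^sub>4) c. meet_right (seq_comp (Phi e\<^sub>4) c))"
  have "sequential_op (\<lambda>u. seq_comp (Phi e\<^sub>0)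
      (subT_join (seq_comp (Phi e\<^sub>1) (u \<circ> Inl)) (seq_comp (Phi e\<^sub>2) (u \<circ> Inr))))"
    for e\<^sub>0 e\<^sub>1 e\<^sub>2
    by (intro sequential_op_comp[OF sequential_op_seq_comp] sequential_op_subT_join
        sequential_op_reindex sequential_op_id)
  then have "sequential (T i d)" for i d
    by (cases i) (simp add: T_def sequential_op_def)
  moreover have "sequential_op (L i)" for i
    unfolding L_def by (cases i)
      (simp add: sequential_op_comp[OF sequential_op_meet_left] sequential_op_seq_comp)
  moreover have "sequential_op (N i)" for i
    unfolding N_def by (cases i)
      (simp add: sequential_op_comp[OF sequential_op_meet_right] sequential_op_seq_comp)
  ultimately have "\<exists>b c. \<forall>i. \<exists>d s r x. block E b c d s r x \<and>
      T i d (candidate_oracle E (L i) (N i) b c) \<noteq> Some x"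
    using assms by (rule ex_blocks_avoiding_candidates)
  moreover have "T i d (candidate_oracle E (L i) (N i) b c) =
      join_meet_computation i (b |` E) b c (h d)" for i d b c
    by (cases i)
      (simp add: T_def L_def N_def candidate_oracle_def case_sum_o_inj subT_meet_eq_map_inter)
  ultimately show ?thesis by simp
qed

section \<open>Programs for chains of queries\<close>

definition total_recursive :: "(nat \<Rightarrow> nat) \<Rightarrow> bool" where
  "total_recursive f \<longleftrightarrow> (\<exists>p. \<forall>n. eval p n = Some (f n))"

lemma total_recursiveI: "(\<And>n. eval p n = Some (f n)) \<Longrightarrow> total_recursive f"
  unfolding total_recursive_def by blast

lemma total_recursive_comp:
  assumes "total_recursive f" "total_recursive g"
  shows "total_recursive (\<lambda>x. f (g x))"
proof -
  obtain p q where "\<And>n. eval p n = Some (f n)" "\<And>n. eval q n = Some (g n)"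
    using assms unfolding total_recursive_def by blast
  then show ?thesis by (intro total_recursiveI[of "Comp p q"]) simp
qed

lemma total_recursive_zero: "total_recursive (\<lambda>x. 0)"
  by (rule total_recursiveI[of Zero]) simp

lemma total_recursive_id: "total_recursive (\<lambda>x. x)"
  by (rule total_recursiveI[of "Pairing Fst Snd"]) simp

lemma total_recursive_Suc: "total_recursive f \<Longrightarrow> total_recursive (\<lambda>x. Suc (f x))"
  by (rule total_recursive_comp[of Suc]) (auto intro: total_recursiveI[of Succ])

lemma total_recursive_fst: "total_recursive f \<Longrightarrow> total_recursive (\<lambda>x. fst (prod_decode (f x)))"
  by (rule total_recursive_comp[of "\<lambda>x. fst (prod_decode x)"])
    (auto intro: total_recursiveI[of Fst])

lemma total_recursive_snd: "total_recursive f \<Longrightarrow> total_recursive (\<lambda>x. snd (prod_decode (f x)))"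
  by (rule total_recursive_comp[of "\<lambda>x. snd (prod_decode x)"])
    (auto intro: total_recursiveI[of Snd])

lemma total_recursive_rec_nat:
  assumes "total_recursive f" "total_recursive g" "total_recursive k"
  shows "total_recursive (\<lambda>x. rec_nat (f x) (\<lambda>m y. g (prod_encode (x, prod_encode (m, y)))) (k x))"
proof -
  obtain p\<^sub>f p\<^sub>g p\<^sub>k where eval: "\<And>n. eval p\<^sub>f n = Some (f n)" "\<And>n. eval p\<^sub>g n = Some (g n)"
      "\<And>n. eval p\<^sub>k n = Some (k n)"
    using assms unfolding total_recursive_def by blast
  have "rec_nat (Some (f x))
      (\<lambda>m r. Option.bind r (\<lambda>y. Some (g (prod_encode (x, prod_encode (m, y)))))) n
      = Some (rec_nat (f x) (\<lambda>m y. g (prod_encode (x, prod_encode (m, y)))) n)" for x n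
    by (induction n) auto
  then have "eval (Comp (Prec p\<^sub>f p\<^sub>g) (Pairing (Pairing Fst Snd) p\<^sub>k)) x =
      Some (rec_nat (f x) (\<lambda>m y. g (prod_encode (x, prod_encode (m, y)))) (k x))" for x
    by (simp add: eval map_comp_def)
  then show ?thesis by (rule total_recursiveI)
qed

lemma total_recursive_if_eq_0:
  assumes "total_recursive k" "total_recursive f" "total_recursive g"
  shows "total_recursive (\<lambda>x. if k x = 0 then f x else g x)"
proof -
  have "total_recursive (\<lambda>x. g (fst (prod_decode x)))"
    by (intro total_recursive_comp[OF assms(3)] total_recursive_fst total_recursive_id)
  from total_recursive_rec_nat[OF assms(2) this assms(1)]
  have "total_recursive (\<lambda>x. rec_nat (f x) (\<lambda>m y. g x) (k x))" by simp
  moreover have "rec_nat (f x) (\<lambda>m y. g x) (k x) = (if k x = 0 then f x else g x)" for x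
    by (cases "k x") auto
  ultimately show ?thesis by simp
qed

lemma total_recursive_pred:
  assumes "total_recursive k"
  shows "total_recursive (\<lambda>x. k x - 1)"
proof -
  have "total_recursive (\<lambda>x. fst (prod_decode (snd (prod_decode x))))"
    by (intro total_recursive_fst total_recursive_snd total_recursive_id)
  from total_recursive_rec_nat[OF total_recursive_zero this assms]
  have "total_recursive (\<lambda>x. rec_nat 0 (\<lambda>m y. m) (k x))" by simp
  moreover have "rec_nat 0 (\<lambda>m y. m) n = n - 1" for n :: nat by (cases n) auto
  ultimately show ?thesis by simp
qed

lemma total_recursive_double:
  assumes "total_recursive k"
  shows "total_recursive (\<lambda>x. 2 * k x)"
proof -
  have "total_recursive (\<lambda>x. Suc (Suc (snd (prod_decode (snd (prod_decode x))))))"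
    by (intro total_recursive_Suc total_recursive_snd total_recursive_id)
  from total_recursive_rec_nat[OF total_recursive_zero this assms]
  have "total_recursive (\<lambda>x. rec_nat 0 (\<lambda>m y. Suc (Suc y)) (k x))" by simp
  moreover have "rec_nat 0 (\<lambda>m y. Suc (Suc y)) n = 2 * n" for n :: nat by (induction n) auto
  ultimately show ?thesis by simp
qed

lemma total_recursive_Suc_double: "total_recursive (\<lambda>x. Suc (2 * x))"
  by (intro total_recursive_Suc total_recursive_double total_recursive_id)

lemma total_recursive_dispatch_length:
  assumes "\<forall>f\<in>set fs. total_recursive f"
  shows "\<exists>h. total_recursive h \<and> (\<forall>\<sigma> x. length \<sigma> < length fs \<longrightarrow>
    h (list_encode (\<sigma> @ [x])) = (fs ! length \<sigma>) x)"
  using assms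
proof (induction fs)
  case Nil
  then show ?case using total_recursive_zero by auto
next
  case (Cons f fs)
  then obtain h where h: "total_recursive h"
    "\<And>\<sigma> x. length \<sigma> < length fs \<Longrightarrow> h (list_encode (\<sigma> @ [x])) = (fs ! length \<sigma>) x"
    by auto
  have f: "total_recursive f" using Cons.prems by simp
  define hd_code where "hd_code m = fst (prod_decode (m - 1))" for m
  define tl_code where "tl_code m = snd (prod_decode (m - 1))" for m
  define h' where "h' m = (if tl_code m = 0 then f (hd_code m) else h (tl_code m))" for m
  have "total_recursive h'"
    unfolding h'_def hd_code_def tl_code_def
    by (intro total_recursive_if_eq_0 total_recursive_comp[OF f] total_recursive_comp[OF h(1)]
        total_recursive_fst total_recursive_snd total_recursive_pred total_recursive_id)
  moreover have "h' (list_encode (\<sigma> @ [x])) = ((f # fs) ! length \<sigma>) x"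
    if "length \<sigma> < length (f # fs)" for \<sigma> x
  proof (cases \<sigma>)
    case Nil
    then show ?thesis by (simp add: h'_def hd_code_def tl_code_def)
  next
    case (Cons a \<tau>)
    have "list_encode (\<tau> @ [x]) \<noteq> 0" by (cases \<tau>) auto
    with that h(2)[of \<tau> x] show ?thesis by (simp add: Cons h'_def tl_code_def)
  qed
  ultimately show ?case by blast
qed

primrec query_chain :: "(nat \<Rightarrow> nat) list \<Rightarrow> (nat \<rightharpoonup> nat) \<Rightarrow> nat \<rightharpoonup> nat" where
  "query_chain [] g x = Some x"
| "query_chain (q # qs) g x = Option.bind (g (q x)) (query_chain qs g)"

lemma query_chain_computable:
  assumes "\<forall>q\<in>set qs. total_recursive q"
  shows "\<exists>e. \<forall>g. seq_comp (Phi e) g = query_chain qs g"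
proof -
  let ?moves = "map (\<lambda>q x. 2 * q x) qs @ [\<lambda>x. Suc (2 * x)]"
  have "\<forall>f\<in>set ?moves. total_recursive f"
    using assms total_recursive_Suc_double by (auto intro: total_recursive_double)
  from total_recursive_dispatch_length[OF this]
  obtain h where "total_recursive h"
    and h: "\<And>\<sigma> x. length \<sigma> < length ?moves \<Longrightarrow>
      h (list_encode (\<sigma> @ [x])) = (?moves ! length \<sigma>) x"
    by blast
  then obtain p where p: "\<And>n. eval p n = Some (h n)" unfolding total_recursive_def by blast
  define e where "e = recf_index p"
  have asks: "Phi e (\<sigma> @ [x]) = Some (0, (qs ! length \<sigma>) x)" if "length \<sigma> < length qs" for \<sigma> x
    using h[of \<sigma> x] that by (simp add: e_def Phi_def recf_of_index p nth_append)
  have outputs: "Phi e (\<sigma> @ [x]) = Some (1, x)" if "length \<sigma> = length qs" for \<sigma> x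
    using h[of \<sigma> x] that by (simp add: e_def Phi_def recf_of_index p nth_append)
  have "run (Phi e) g (\<sigma> @ [x]) = query_chain (drop (length \<sigma>) qs) g x"
    if "length \<sigma> \<le> length qs" for g \<sigma> x
    using that
  proof (induction "drop (length \<sigma>) qs" arbitrary: \<sigma> x)
    case Nil
    then show ?case by (simp add: run.simps outputs)
  next
    case (Cons q qs')
    then have \<sigma>: "length \<sigma> < length qs" "qs ! length \<sigma> = q" "drop (length (\<sigma> @ [x])) qs = qs'"
      by (metis drop_all leI list.distinct(1), metis nth_via_drop,
          metis drop_Suc length_append_singleton list.sel(3) tl_drop)
    then have "run (Phi e) g (\<sigma> @ [x, a]) = query_chain qs' g a" for a
      using Cons.hyps(1)[of "\<sigma> @ [x]" a] by simp
    with \<sigma> Cons.hyps(2)[symmetric] show ?case by (subst run.simps) (simp add: asks)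
  qed
  from this[of "[]"] show ?thesis by (intro exI[of _ e]) (simp add: seq_comp_def fun_eq_iff)
qed

lemma ex_seq_comp_identity: "\<exists>e. \<forall>g. seq_comp (Phi e) g = g"
proof -
  have "query_chain [\<lambda>x. x] g = g" for g
    by (simp add: fun_eq_iff split: Option.bind_split)
  then show ?thesis
    using query_chain_computable[of "[\<lambda>x. x]"] by (simp add: total_recursive_id)
qed

lemma ex_seq_comp_follow_block:
  "\<exists>e. \<forall>E b c d s r x. block E b c d s r x \<longrightarrow>
    seq_comp (Phi e) (subT_join (b |` E) c) d = Some x"
proof -
  let ?queries = "[\<lambda>d. Suc (2 * d), \<lambda>s. 2 * s, \<lambda>r. Suc (2 * r)]"
  have "\<forall>q\<in>set ?queries. total_recursive q"
    using total_recursive_Suc_double total_recursive_double[OF total_recursive_id] by simp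
  then obtain e where "\<And>g. seq_comp (Phi e) g = query_chain ?queries g"
    using query_chain_computable by blast
  then show ?thesis by (intro exI[of _ e]) (simp add: block_def subT_join_def)
qed

lemma ex_subT_meet_follow_block:
  "\<exists>h. \<forall>E b c d s r x. block E b c d s r x \<longrightarrow>
    subT_meet b (subT_join (b |` E) c) (h d) = Some x"
proof -
  obtain i where i: "\<And>g. seq_comp (Phi i) g = g" using ex_seq_comp_identity by blast
  obtain j where j: "\<And>E b c d s r x. block E b c d s r x \<Longrightarrow>
      seq_comp (Phi j) (subT_join (b |` E) c) d = Some x"
    using ex_seq_comp_follow_block by blast
  have "subT_meet b (subT_join (b |` E) c) (prod_encode (i, prod_encode (j, d))) = Some x"
    if "block E b c d s r x" for E b c d s r x
    using that j[OF that] by (simp add: subT_meet_def i block_def)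
  then show ?thesis by (intro exI[of _ "\<lambda>d. prod_encode (i, prod_encode (j, d))"]) simp
qed

section \<open>SubTuring degrees\<close>

lemma subT_leI: "f \<subseteq>\<^sub>m g \<Longrightarrow> f \<le>\<^sub>s\<^sub>u\<^sub>b\<^sub>T g"
  unfolding subT_le_def by (metis ex_seq_comp_identity)

abbreviation subT_degree :: "(nat \<rightharpoonup> nat) \<Rightarrow> (nat \<rightharpoonup> nat) set" where
  "subT_degree f \<equiv> subT_equiv `` {f}"

lemma subT_degree_in_degrees: "subT_degree f \<in> subT_degrees"
  by (simp add: subT_degrees_def quotientI)

lemma self_in_subT_degree: "f \<in> subT_degree f"
  by (simp add: subT_equiv_def subT_leI)

lemma degree_leI: "f \<le>\<^sub>s\<^sub>u\<^sub>b\<^sub>T g \<Longrightarrow> degree_le (subT_degree f) (subT_degree g)"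
  unfolding degree_le_def using self_in_subT_degree by blast

lemma degree_joinI: "f \<in> a \<Longrightarrow> g \<in> b \<Longrightarrow> subT_join f g \<in> degree_join a b"
  unfolding degree_join_def using self_in_subT_degree by blast

lemma degree_meetI: "f \<in> a \<Longrightarrow> g \<in> b \<Longrightarrow> subT_meet f g \<in> degree_meet a b"
  unfolding degree_meet_def using self_in_subT_degree by blast

lemma degree_joinE:
  assumes "h \<in> degree_join (subT_degree f) b"
  obtains g e\<^sub>0 e\<^sub>1 where "g \<in> b" "h \<subseteq>\<^sub>m seq_comp (Phi e\<^sub>0) (subT_join (seq_comp (Phi e\<^sub>1) f) g)"
proof -
  obtain f' g where "g \<in> b" and "f' \<le>\<^sub>s\<^sub>u\<^sub>b\<^sub>T f" "h \<le>\<^sub>s\<^sub>u\<^sub>b\<^sub>T subT_join f' g"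
    using assms by (auto simp: degree_join_def subT_equiv_def)
  then obtain e\<^sub>0 e\<^sub>1 where "f' \<subseteq>\<^sub>m seq_comp (Phi e\<^sub>1) f"
    and h: "h \<subseteq>\<^sub>m seq_comp (Phi e\<^sub>0) (subT_join f' g)"
    by (auto simp: subT_le_def)
  then have "seq_comp (Phi e\<^sub>0) (subT_join f' g)
      \<subseteq>\<^sub>m seq_comp (Phi e\<^sub>0) (subT_join (seq_comp (Phi e\<^sub>1) f) g)"
    by (intro seq_comp_mono subT_join_mono map_le_refl)
  from map_le_trans[OF h this] \<open>g \<in> b\<close> show thesis by (rule that[rotated])
qed

lemma degree_meetE:
  assumes "h \<in> degree_meet (subT_degree f) (subT_degree g)"
  obtains e\<^sub>0 e\<^sub>1 e\<^sub>2 where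
    "h \<subseteq>\<^sub>m seq_comp (Phi e\<^sub>0) (subT_meet (seq_comp (Phi e\<^sub>1) f) (seq_comp (Phi e\<^sub>2) g))"
proof -
  obtain f' g' where "f' \<le>\<^sub>s\<^sub>u\<^sub>b\<^sub>T f" "g' \<le>\<^sub>s\<^sub>u\<^sub>b\<^sub>T g" "h \<le>\<^sub>s\<^sub>u\<^sub>b\<^sub>T subT_meet f' g'"
    using assms by (auto simp: degree_meet_def subT_equiv_def)
  then obtain e\<^sub>0 e\<^sub>1 e\<^sub>2 where "f' \<subseteq>\<^sub>m seq_comp (Phi e\<^sub>1) f" "g' \<subseteq>\<^sub>m seq_comp (Phi e\<^sub>2) g"
    and h: "h \<subseteq>\<^sub>m seq_comp (Phi e\<^sub>0) (subT_meet f' g')"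
    by (auto simp: subT_le_def)
  then have "seq_comp (Phi e\<^sub>0) (subT_meet f' g')
      \<subseteq>\<^sub>m seq_comp (Phi e\<^sub>0) (subT_meet (seq_comp (Phi e\<^sub>1) f) (seq_comp (Phi e\<^sub>2) g))"
    by (intro seq_comp_mono subT_meet_mono)
  with h show thesis by (intro that map_le_trans[OF h])
qed

lemma degree_join_meetE:
  assumes "h \<in> degree_join (subT_degree a) (degree_meet (subT_degree b) (subT_degree c))"
  obtains i where "h \<subseteq>\<^sub>m join_meet_computation i a b c"
proof -
  obtain g e\<^sub>0 e\<^sub>1 where "g \<in> degree_meet (subT_degree b) (subT_degree c)"
    and h: "h \<subseteq>\<^sub>m seq_comp (Phi e\<^sub>0) (subT_join (seq_comp (Phi e\<^sub>1) a) g)"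
    using degree_joinE[OF assms] by blast
  from this(1) obtain e\<^sub>2 e\<^sub>3 e\<^sub>4
    where "g \<subseteq>\<^sub>m seq_comp (Phi e\<^sub>2) (subT_meet (seq_comp (Phi e\<^sub>3) b) (seq_comp (Phi e\<^sub>4) c))"
    by (rule degree_meetE)
  then have "h \<subseteq>\<^sub>m join_meet_computation (e\<^sub>0, e\<^sub>1, e\<^sub>2, e\<^sub>3, e\<^sub>4) a b c"
    unfolding join_meet_computation.simps
    by (intro map_le_trans[OF h] seq_comp_mono subT_join_mono map_le_refl)
  then show thesis by (rule that)
qed

lemma infinite_even_nat: "infinite {n :: nat. even n}"
proof (rule infinite_super)
  show "infinite (range (\<lambda>n :: nat. 2 * n))" by (simp add: finite_image_iff inj_on_def)
qed auto

lemma infinite_odd_nat: "infinite (- {n :: nat. even n})"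
proof (rule infinite_super)
  show "infinite (range (\<lambda>n :: nat. 2 * n + 1))" by (simp add: finite_image_iff inj_on_def)
qed auto

theorem theorem4p10:
  "\<exists>a\<in>subT_degrees. \<exists>b\<in>subT_degrees. \<exists>c\<in>subT_degrees.
     degree_le a b \<and>
     degree_join a (degree_meet b c) \<noteq> degree_meet b (degree_join a c)"
proof -
  let ?E = "{n :: nat. even n}"
  obtain h where h: "\<And>b c d s r x. block ?E b c d s r x \<Longrightarrow>
      subT_meet b (subT_join (b |` ?E) c) (h d) = Some x"
    using ex_subT_meet_follow_block by metis
  obtain b c where avoid: "\<And>i. \<exists>d s r x. block ?E b c d s r x \<and>
      join_meet_computation i (b |` ?E) b c (h d) \<noteq> Some x"
    using ex_blocks_avoiding_computations[OF infinite_even_nat infinite_odd_nat] by metis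
  let ?a = "b |` ?E"
  let ?m = "subT_meet b (subT_join ?a c)"
  have "?m \<notin> degree_join (subT_degree ?a) (degree_meet (subT_degree b) (subT_degree c))"
  proof
    assume "?m \<in> degree_join (subT_degree ?a) (degree_meet (subT_degree b) (subT_degree c))"
    then obtain i where i: "?m \<subseteq>\<^sub>m join_meet_computation i ?a b c" by (rule degree_join_meetE)
    show False using avoid[of i] map_le_SomeD[OF i h] by blast
  qed
  moreover have "?m \<in> degree_meet (subT_degree b) (degree_join (subT_degree ?a) (subT_degree c))"
    by (intro degree_meetI degree_joinI self_in_subT_degree)
  moreover have "degree_le (subT_degree ?a) (subT_degree b)"
    by (intro degree_leI subT_leI restrict_map_le)
  ultimately show ?thesis by (metis subT_degree_in_degrees)
qed

end
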